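(* Let $(P_n,\beta)$ be the edge-labeled path graph with vertices $v_1,\dots,v_n$ (in this order along the path), module $m_j\mathbb{Z}$ at $v_j$ and module $\mathbb{Z}/r_k\mathbb{Z}$ at the edge $v_kv_{k+1}$, where $m_1,\dots,m_n,r_1,\dots,r_{n-1}\in\mathbb{Z}$; set $r_0=1$. Let $B=\{F^{(1)},\dots,F^{(n)}\}$ be a set of flow-up classes, where each $F^{(i)}=(0,\dots,0,f^{(i)}_{v_i},\dots,f^{(i)}_{v_n})\in\hat{\mathcal{F}}_i$ is minimal with first nonzero entry $$f^{(i)}_{v_i}=[m_i,r_{i-1},(m_{i+1},r_i),(m_{i+2},r_i,r_{i+1}),\dots,(m_n,r_i,r_{i+1},\dots,r_{n-1})]$$ for $i=1,2,\dots,n$. Then $B$ forms a module basis over $\mathbb{Z}$ for the module $\hat{R}_{P_n}$ of splines on $(P_n,\beta)$.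
   Context: Notation: $(\ )$ denotes the greatest common divisor and $[\ ]$ the least common multiple of integers. A spline on $(P_n,\beta)$ is a tuple $(f_{v_1},\dots,f_{v_n})$ of integers with $f_{v_j}\in m_j\mathbb{Z}$ for all $j$ and $f_{v_k}\equiv f_{v_{k+1}}\pmod{r_k}$ for $k=1,\dots,n-1$; the $\mathbb{Z}$-module of all splines is $\hat{R}_{P_n}$. An $i$-th flow-up class is a spline with $f_{v_i}\neq0$ and $f_{v_s}=0$ for all $s<i$; the set of these is $\hat{\mathcal{F}}_i$. The leading term of a flow-up class $F^{(i)}\in\hat{\mathcal{F}}_i$ is its first nonzero entry $f^{(i)}_{v_i}$; the leading terms of elements of $\hat{\mathcal{F}}_i$ (together with $0$) form an ideal $LT(\hat{\mathcal{F}}_i)$ of $\mathbb{Z}$, and $F^{(i)}$ is called minimal if its leading term generates this ideal. *)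

theory Defs
  imports Complex_Main "HOL-Library.Function_Algebras" "HOL-Number_Theory.Cong"
begin

text \<open>
  A tuple \<open>(f\<^sub>1, \<dots>, f\<^sub>n)\<close> of integers is a function \<open>f :: nat \<Rightarrow> int\<close> that vanishes outside
  \<open>{1..n}\<close>, so that equality of functions is equality of tuples. The vertex labels are
  \<open>m 1, \<dots>, m n\<close> and \<open>r k\<close> labels the edge joining vertices \<open>k\<close> and \<open>k + 1\<close>.
\<close>

definition splines :: "nat \<Rightarrow> (nat \<Rightarrow> int) \<Rightarrow> (nat \<Rightarrow> int) \<Rightarrow> (nat \<Rightarrow> int) set" where
  "splines n m r = {f. (\<forall>j. j \<notin> {1..n} \<longrightarrow> f j = 0) \<and>
                       (\<forall>j\<in>{1..n}. m j dvd f j) \<and>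
                       (\<forall>k\<in>{1..<n}. [f k = f (k + 1)] (mod r k))}"

definition flow_up :: "nat \<Rightarrow> (nat \<Rightarrow> int) \<Rightarrow> (nat \<Rightarrow> int) \<Rightarrow> nat \<Rightarrow> (nat \<Rightarrow> int) set" where
  "flow_up n m r i = {f \<in> splines n m r. f i \<noteq> 0 \<and> (\<forall>s\<in>{1..<i}. f s = 0)}"

definition LT :: "nat \<Rightarrow> (nat \<Rightarrow> int) \<Rightarrow> (nat \<Rightarrow> int) \<Rightarrow> nat \<Rightarrow> int set" where
  "LT n m r i = insert 0 ((\<lambda>f. f i) ` flow_up n m r i)"

definition minimal_flow_up ::
    "nat \<Rightarrow> (nat \<Rightarrow> int) \<Rightarrow> (nat \<Rightarrow> int) \<Rightarrow> nat \<Rightarrow> (nat \<Rightarrow> int) \<Rightarrow> bool" where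
  "minimal_flow_up n m r i f \<longleftrightarrow> f \<in> flow_up n m r i \<and> LT n m r i = range (\<lambda>c. c * f i)"

definition zscale :: "int \<Rightarrow> (nat \<Rightarrow> int) \<Rightarrow> nat \<Rightarrow> int" where
  "zscale c f = (\<lambda>j. c * f j)"

lemma module_zscale: "module zscale"
  by unfold_locales (auto simp: zscale_def fun_eq_iff algebra_simps)

lemma subspace_splines: "module.subspace zscale (splines n m r)"
  unfolding module.subspace_def[OF module_zscale]
  by (auto simp: splines_def zscale_def intro: cong_add cong_mult)

text \<open>
  A basis of a submodule \<open>M\<close> of the \<open>int\<close>-module of all functions \<open>nat \<Rightarrow> int\<close> under pointwise
  addition and \<open>zscale\<close>.
\<close>

definition Z_basis :: "(nat \<Rightarrow> int) set \<Rightarrow> (nat \<Rightarrow> int) set \<Rightarrow> bool" where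
  "Z_basis B M \<longleftrightarrow> \<not> module.dependent zscale B \<and> module.span zscale B = M"

end

theory Submission
  imports Defs
begin

text \<open>
  Minimality makes the flow-up classes a triangular system: the first nonzero entry of a spline, at
  \<open>i\<close> say, is a multiple of the leading term of \<open>F i\<close>, so subtracting a multiple of \<open>F i\<close> moves the
  first nonzero entry to the right.
\<close>

interpretation Z: module zscale
  by (rule module_zscale)

lemma sum_fun_apply:
  fixes g :: "'a \<Rightarrow> 'b \<Rightarrow> 'c::comm_monoid_add"
  shows "(\<Sum>v\<in>A. g v) x = (\<Sum>v\<in>A. g v x)"
  by (induction A rule: infinite_finite_induct) simp_all

text \<open>In a vanishing combination, look at the least index whose coefficient is nonzero. At
  that vertex, earlier classes have coefficient zero and later ones have entry zero, so a single
  nonzero leading term would have to vanish.\<close>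

lemma flow_up_independent:
  assumes F: "\<And>i. i \<in> {1..n} \<Longrightarrow> F i \<in> flow_up n m r i"
  shows "\<not> Z.dependent (F ` {1..n})"
proof
  assume "Z.dependent (F ` {1..n})"
  then obtain t u where t: "finite t" "t \<subseteq> F ` {1..n}" "(\<Sum>v\<in>t. zscale (u v) v) = 0"
    and "\<exists>v\<in>t. u v \<noteq> 0"
    unfolding Z.dependent_explicit by blast
  then have ex: "\<exists>i. i \<in> {1..n} \<and> F i \<in> t \<and> u (F i) \<noteq> 0"
    by blast
  define i where "i = (LEAST i. i \<in> {1..n} \<and> F i \<in> t \<and> u (F i) \<noteq> 0)"
  have i: "i \<in> {1..n}" "F i \<in> t" "u (F i) \<noteq> 0"
    using LeastI_ex[OF ex] unfolding i_def by auto
  \<comment> \<open>The sum runs over functions, not indices: each remaining \<open>v\<close> is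
    some \<open>F j\<close>, and \<open>v \<noteq> F i\<close> forces
    \<open>j \<noteq> i\<close>.\<close>
  have rest: "u v * v i = 0" if v: "v \<in> t - {F i}" for v
  proof -
    obtain j where j: "j \<in> {1..n}" "v = F j" "F j \<in> t" "j \<noteq> i"
      using v t(2) by blast
    show ?thesis
    proof (cases "j < i")
      case True
      then have "u (F j) = 0"
        using not_less_Least[of j] j unfolding i_def by blast
      then show ?thesis using j by simp
    next
      case False
      then have "F j i = 0"
        using F[OF j(1)] i(1) j(4) unfolding flow_up_def by auto
      then show ?thesis using j by simp
    qed
  qed
  have rest_sum: "(\<Sum>v\<in>t - {F i}. u v * v i) = 0"
    by (intro sum.neutral ballI rest)
  have "0 = (\<Sum>v\<in>t. zscale (u v) v) i"
    using t(3) by simp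
  also have "\<dots> = (\<Sum>v\<in>t. u v * v i)"
    by (simp add: sum_fun_apply zscale_def)
  also have "\<dots> = u (F i) * F i i"
    by (simp add: sum.remove[OF t(1) i(2)] rest_sum)
  finally show False
    using i(3) F[OF i(1)] by (simp add: flow_up_def)
qed

text \<open>For \<open>k \<le> n\<close>, the induction parameter \<open>k\<close> counts the final
  vertices at which \<open>f\<close> may still be nonzero; each step clears the first of
  them.\<close>

lemma minimal_flow_up_span:
  assumes F: "\<And>i. i \<in> {1..n} \<Longrightarrow> minimal_flow_up n m r i (F i)"
    and "f \<in> splines n m r" and "\<forall>s\<in>{1..n - k}. f s = 0"
  shows "f \<in> Z.span (F ` {1..n})"
  using assms(2,3)
proof (induction k arbitrary: f)
  case 0
  then have "f = 0"
    by (auto simp: splines_def fun_eq_iff)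
  then show ?case
    using Z.span_zero by blast
next
  case (Suc k)
  show ?case
  proof (cases "k < n")
    case False
    \<comment> \<open>Here \<open>n - Suc k\<close> and \<open>n - k\<close> both truncate to 0, so
      the induction hypothesis applies to \<open>f\<close> itself.\<close>
    then show ?thesis using Suc by simp
  next
    case True
    define i where "i = n - k"
    have i: "i \<in> {1..n}" "n - Suc k = i - 1"
      using True by (auto simp: i_def)
    have Fi: "F i \<in> splines n m r" "\<forall>s\<in>{1..<i}. F i s = 0"
      "LT n m r i = range (\<lambda>c. c * F i i)"
      using F[OF i(1)] by (auto simp: minimal_flow_up_def flow_up_def)
    have f0: "f s = 0" if "s \<in> {1..<i}" for s
      using Suc.prems(2) that i by auto
    \<comment> \<open>If \<open>f i\<close> is nonzero, \<open>f\<close> is itself a flow-up class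
      at \<open>i\<close>; otherwise the 0 adjoined to \<open>LT\<close> covers it.\<close>
    have "f i \<in> LT n m r i"
      using Suc.prems(1) f0 by (cases "f i = 0") (auto simp: LT_def flow_up_def)
    then obtain c where c: "f i = c * F i i"
      using Fi(3) by auto
    \<comment> \<open>The multiple \<open>c\<close> cancels the entry at \<open>i = n - k\<close>,
      so \<open>g\<close> vanishes exactly as far as the induction hypothesis asks.\<close>
    define g where "g = f - zscale c (F i)"
    have "g \<in> splines n m r"
      unfolding g_def using subspace_splines Suc.prems(1) Fi(1)
      by (intro Z.subspace_diff Z.subspace_scale)
    moreover have "g s = 0" if "s \<in> {1..i}" for s
      using that c f0[of s] Fi(2) by (cases "s = i") (auto simp: g_def zscale_def)
    ultimately have "g \<in> Z.span (F ` {1..n})"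
      using Suc.IH by (simp add: i_def)
    moreover have "zscale c (F i) \<in> Z.span (F ` {1..n})"
      using i(1) by (intro Z.span_scale Z.span_base) auto
    ultimately have "g + zscale c (F i) \<in> Z.span (F ` {1..n})"
      by (rule Z.span_add)
    then show ?thesis
      by (simp add: g_def)
  qed
qed

theorem theorem5p4:
  fixes n :: nat and m r :: "nat \<Rightarrow> int" and F :: "nat \<Rightarrow> nat \<Rightarrow> int"
    and B :: "(nat \<Rightarrow> int) set"
  assumes "n \<ge> 1"
    and "r 0 = 1"
    and "B = F ` {1..n}"
    and "\<And>i. i \<in> {1..n} \<Longrightarrow> minimal_flow_up n m r i (F i)"
    and "\<And>i. i \<in> {1..n} \<Longrightarrow>
           F i i = Lcm ({m i, r (i - 1)} \<union>
                        (\<lambda>j. Gcd (insert (m j) (r ` {i..<j}))) ` {i<..n})"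
  shows "Z_basis B (splines n m r)"
  unfolding Z_basis_def assms(3)
proof
  have flow: "F i \<in> flow_up n m r i" if "i \<in> {1..n}" for i
    using assms(4)[OF that] by (simp add: minimal_flow_up_def)
  then show "\<not> Z.dependent (F ` {1..n})"
    by (rule flow_up_independent)
  have "F ` {1..n} \<subseteq> splines n m r"
    using flow by (auto simp: flow_up_def)
  then have "Z.span (F ` {1..n}) \<subseteq> splines n m r"
    using subspace_splines by (rule Z.span_minimal)
  \<comment> \<open>With \<open>k = n\<close> the range of prescribed zeros is empty, so every
    spline qualifies.\<close>
  moreover have "splines n m r \<subseteq> Z.span (F ` {1..n})"
    using minimal_flow_up_span[OF assms(4), where k = n] by auto
  ultimately show "Z.span (F ` {1..n}) = splines n m r"
    by (rule equalityI)
qed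

end
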